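(* Let $M$ be an $\mathbb{O}$-bimodule and $\mathscr{A}(M)=\{m\in M\mid [p,q,m]=0\ \forall p,q\in\mathbb{O}\}$. Then $$\mathscr{A}(M)=\Big\{x+\frac1{48}\sum_{i,j,k=1}^7\epsilon_{ijk}\,e_i[e_j,e_k,x]\;\Big|\;x\in M\Big\}.$$
   Context: $\mathbb{O}$ is the real division algebra of octonions with its standard real basis $1,e_1,\ldots,e_7$ multiplied according to the Fano plane; the symbols $\epsilon_{ijk}\in\{0,\pm1\}$ ($1\le i,j,k\le7$) are the totally skew-symmetric structure constants given by $e_ie_j=\sum_{k}\epsilon_{ijk}e_k-\delta_{ij}$. A left $\mathbb{O}$-module is a real vector space $M$ with an $\mathbb{R}$-bilinear map $\mathbb{O}\times M\to M$, $(p,m)\mapsto pm$, such that $1m=m$ and $[p,q,m]=-[q,p,m]$ for all $p,q\in\mathbb{O}$, $m\in M$, where $[p,q,m]:=(pq)m-p(qm)$. An $\mathbb{O}$-bimodule is a left $\mathbb{O}$-module $M$ with in addition an $\mathbb{R}$-bilinear right multiplication $M\times\mathbb{O}\to M$, $(m,p)\mapsto mp$, with $m1=m$, such that $[p,q,m]=[m,p,q]=[q,m,p]$ for all $p,q\in\mathbb{O}$, $m\in M$, where $[m,p,q]:=(mp)q-m(pq)$ and $[q,m,p]:=(qm)p-q(mp)$. *)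

theory Defs
  imports "HOL-Analysis.Analysis"
begin

section \<open>The octonions\<close>

text \<open>An octonion is given by its eight real coordinates: \<open>coord x 0\<close> is the real part
  and \<open>coord x i\<close>, for \<open>1 \<le> i \<le> 7\<close>, is the coefficient of the imaginary unit \<open>e\<^sub>i\<close>.\<close>

typedef octonion = "{f :: nat \<Rightarrow> real. \<forall>n>7. f n = 0}"
  morphisms coord Abs_octonion
  by (rule exI[of _ "\<lambda>_. 0"]) simp

setup_lifting type_definition_octonion

text \<open>The seven oriented lines of the Fano plane: \<open>(i, j, k)\<close> stands for \<open>e\<^sub>i e\<^sub>j = e\<^sub>k\<close> and its
  cyclic rotations.\<close>

definition fano_lines :: "(nat \<times> nat \<times> nat) set" where
  "fano_lines = {(1,2,3), (1,4,5), (1,7,6), (2,4,6), (2,5,7), (3,4,7), (3,6,5)}"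

definition eps :: "nat \<Rightarrow> nat \<Rightarrow> nat \<Rightarrow> real" where
  "eps i j k =
    (if (i,j,k) \<in> fano_lines \<or> (j,k,i) \<in> fano_lines \<or> (k,i,j) \<in> fano_lines then 1
     else if (j,i,k) \<in> fano_lines \<or> (i,k,j) \<in> fano_lines \<or> (k,j,i) \<in> fano_lines then -1
     else 0)"

instantiation octonion :: real_vector
begin

lift_definition zero_octonion :: octonion is "\<lambda>_. 0" by simp
lift_definition plus_octonion :: "octonion \<Rightarrow> octonion \<Rightarrow> octonion" is "\<lambda>f g n. f n + g n" by simp
lift_definition minus_octonion :: "octonion \<Rightarrow> octonion \<Rightarrow> octonion" is "\<lambda>f g n. f n - g n" by simp
lift_definition uminus_octonion :: "octonion \<Rightarrow> octonion" is "\<lambda>f n. - f n" by simp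
lift_definition scaleR_octonion :: "real \<Rightarrow> octonion \<Rightarrow> octonion" is "\<lambda>r f n. r * f n" by simp

instance
  by standard (transfer; simp add: fun_eq_iff algebra_simps)+

end

instantiation octonion :: "{one, times}"
begin

lift_definition one_octonion :: octonion is "\<lambda>n. if n = 0 then 1 else 0" by simp

lift_definition times_octonion :: "octonion \<Rightarrow> octonion \<Rightarrow> octonion" is
  "\<lambda>f g k. if k = 0 then f 0 * g 0 - (\<Sum>i=1..7. f i * g i)
     else if k \<le> 7 then f 0 * g k + f k * g 0 + (\<Sum>i=1..7. \<Sum>j=1..7. eps i j k * f i * g j)
     else 0"
  by simp

instance ..

end

lift_definition unit_oct :: "nat \<Rightarrow> octonion" is
  "\<lambda>i n. if n = i \<and> i \<le> 7 then 1 else 0" by simp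

lemma octonion_eq_iff: "x = y \<longleftrightarrow> (\<forall>n\<in>{..7}. coord x n = coord y n)"
proof
  assume eq: "\<forall>n\<in>{..7}. coord x n = coord y n"
  have "coord x n = coord y n" for n
    using eq coord[of x] coord[of y] by (cases "n \<le> 7") auto
  then show "x = y"
    by (simp add: coord_inject[symmetric] fun_eq_iff)
qed simp

lemma sum_1_7: "(\<Sum>i=1..7. f i) = f 1 + f 2 + f 3 + f 4 + f 5 + f 6 + f (7::nat)"
  for f :: "nat \<Rightarrow> 'a::comm_monoid_add"
  by (simp add: eval_nat_numeral add.assoc)

lemma ball_atMost_7: "(\<forall>n\<in>{..7::nat}. P n) \<longleftrightarrow>
    P 0 \<and> P 1 \<and> P 2 \<and> P 3 \<and> P 4 \<and> P 5 \<and> P 6 \<and> P 7"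
proof -
  have "{..7::nat} = {0,1,2,3,4,5,6,7}"
    by (auto simp: eval_nat_numeral atMost_Suc)
  then show ?thesis by simp
qed

lemma coord_times:
  "coord (x * y) 0 = coord x 0 * coord y 0 - (\<Sum>i=1..7. coord x i * coord y i)"
  "k \<in> {1..7} \<Longrightarrow> coord (x * y) k = coord x 0 * coord y k + coord x k * coord y 0
     + (\<Sum>i=1..7. \<Sum>j=1..7. eps i j k * coord x i * coord y j)"
  by (simp_all add: times_octonion.rep_eq)

lemmas coord_simps = zero_octonion.rep_eq plus_octonion.rep_eq minus_octonion.rep_eq
  uminus_octonion.rep_eq scaleR_octonion.rep_eq one_octonion.rep_eq unit_oct.rep_eq

lemma coord_times_explicit:
  fixes x y :: octonion
  defines "a \<equiv> coord x" and "b \<equiv> coord y"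
  shows
    "coord (x * y) 0 = a 0 * b 0 - a 1 * b 1 - a 2 * b 2 - a 3 * b 3 - a 4 * b 4 - a 5 * b 5 - a 6 * b 6 - a 7 * b 7"
    "coord (x * y) 1 = a 0 * b 1 + a 1 * b 0 + a 2 * b 3 - a 3 * b 2 + a 4 * b 5 - a 5 * b 4 + a 7 * b 6 - a 6 * b 7"
    "coord (x * y) 2 = a 0 * b 2 + a 2 * b 0 + a 3 * b 1 - a 1 * b 3 + a 4 * b 6 - a 6 * b 4 + a 5 * b 7 - a 7 * b 5"
    "coord (x * y) 3 = a 0 * b 3 + a 3 * b 0 + a 1 * b 2 - a 2 * b 1 + a 4 * b 7 - a 7 * b 4 + a 6 * b 5 - a 5 * b 6"
    "coord (x * y) 4 = a 0 * b 4 + a 4 * b 0 + a 5 * b 1 - a 1 * b 5 + a 6 * b 2 - a 2 * b 6 + a 7 * b 3 - a 3 * b 7"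
    "coord (x * y) 5 = a 0 * b 5 + a 5 * b 0 + a 1 * b 4 - a 4 * b 1 + a 7 * b 2 - a 2 * b 7 + a 3 * b 6 - a 6 * b 3"
    "coord (x * y) 6 = a 0 * b 6 + a 6 * b 0 + a 1 * b 7 - a 7 * b 1 + a 2 * b 4 - a 4 * b 2 + a 5 * b 3 - a 3 * b 5"
    "coord (x * y) 7 = a 0 * b 7 + a 7 * b 0 + a 6 * b 1 - a 1 * b 6 + a 2 * b 5 - a 5 * b 2 + a 3 * b 4 - a 4 * b 3"
  unfolding a_def b_def
  by (simp_all add: coord_times sum_1_7 eps_def fano_lines_def del: One_nat_def)

lemma coord_sum: "coord (sum f A) n = (\<Sum>x\<in>A. coord (f x) n)"
  by (induction A rule: infinite_finite_induct) (simp_all add: coord_simps)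

lemma unit_oct_mult:
  assumes "i \<in> {1..7}" "j \<in> {1..7}"
  shows "unit_oct i * unit_oct j =
    (\<Sum>k=1..7. eps i j k *\<^sub>R unit_oct k) - (if i = j then 1 else 0)"
proof -
  have delta: "coord (unit_oct m) n = (if n = m then 1 else 0)" if "m \<in> {1..7}" for m n
    using that by (simp add: coord_simps)
  have rhs: "coord (\<Sum>k=1..7. eps i j k *\<^sub>R unit_oct k) n = (if n \<in> {1..7} then eps i j n else 0)" for n
  proof -
    have "coord (\<Sum>k=1..7. eps i j k *\<^sub>R unit_oct k) n = (\<Sum>k=1..7. if n = k then eps i j k else 0)"
      unfolding coord_sum by (rule sum.cong) (simp_all add: coord_simps)
    then show ?thesis by simp
  qed
  have "coord (unit_oct i * unit_oct j) 0 = (if i = j then -1 else 0)"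
    using assms by (simp add: coord_times delta if_distrib[of "\<lambda>u. u * _"] cong: if_cong)
  moreover have "coord (unit_oct i * unit_oct j) k = eps i j k" if "k \<in> {1..7}" for k
  proof -
    have "(\<Sum>i'=1..7. \<Sum>j'=1..7. eps i' j' k * coord (unit_oct i) i' * coord (unit_oct j) j')
        = (\<Sum>i'=1..7. \<Sum>j'=1..7. if j' = j then (if i' = i then eps i' j' k else 0) else 0)"
      using assms by (intro sum.cong) (simp_all add: delta)
    also have "\<dots> = eps i j k"
      using assms by simp
    finally show ?thesis
      using assms that by (simp add: coord_times delta)
  qed
  ultimately have "coord (unit_oct i * unit_oct j) n =
      coord ((\<Sum>k=1..7. eps i j k *\<^sub>R unit_oct k) - (if i = j then 1 else 0)) n" if "n \<le> 7" for n
    using that by (cases "n = 0") (simp_all add: rhs coord_simps del: One_nat_def)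
  then show ?thesis
    by (simp add: octonion_eq_iff)
qed

lemma octonion_left_alternative: "(x * x) * y = x * (x * y)" for x y :: octonion
  unfolding octonion_eq_iff ball_atMost_7 coord_times_explicit
  by (simp add: algebra_simps del: One_nat_def)

lemma octonion_right_alternative: "(y * x) * x = y * (x * x)" for x y :: octonion
  unfolding octonion_eq_iff ball_atMost_7 coord_times_explicit
  by (simp add: algebra_simps del: One_nat_def)

lemma octonion_norm_mult:
  "(\<Sum>n\<le>7. (coord (x * y) n)\<^sup>2) = (\<Sum>n\<le>7. (coord x n)\<^sup>2) * (\<Sum>n\<le>7. (coord y n)\<^sup>2)"
proof -
  have sum_0_7: "sum f {..7} = f 0 + f 1 + f 2 + f 3 + f 4 + f 5 + f 6 + f (7::nat)" for f :: "nat \<Rightarrow> real"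
    by (simp add: eval_nat_numeral)
  show ?thesis
    unfolding sum_0_7 coord_times_explicit
    by algebra
qed

lemma octonion_no_zero_divisors:
  fixes x y :: octonion
  assumes "x * y = 0"
  shows "x = 0 \<or> y = 0"
proof -
  have nz: "(\<Sum>n\<le>7. (coord z n)\<^sup>2) = 0 \<longleftrightarrow> z = 0" for z
    by (subst sum_nonneg_eq_0_iff) (auto simp: octonion_eq_iff coord_simps)
  show ?thesis
    using octonion_norm_mult[of x y] assms nz by (metis mult_eq_0_iff)
qed


section \<open>Octonionic modules\<close>

definition left_assoc :: "(octonion \<Rightarrow> 'm \<Rightarrow> 'm) \<Rightarrow> octonion \<Rightarrow> octonion \<Rightarrow> 'm \<Rightarrow> 'm::real_vector" where
  "left_assoc l p q m = l (p * q) m - l p (l q m)"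

definition right_assoc :: "('m \<Rightarrow> octonion \<Rightarrow> 'm) \<Rightarrow> 'm \<Rightarrow> octonion \<Rightarrow> octonion \<Rightarrow> 'm::real_vector" where
  "right_assoc r m p q = r (r m p) q - r m (p * q)"

definition middle_assoc ::
  "(octonion \<Rightarrow> 'm \<Rightarrow> 'm) \<Rightarrow> ('m \<Rightarrow> octonion \<Rightarrow> 'm) \<Rightarrow> octonion \<Rightarrow> 'm \<Rightarrow> octonion \<Rightarrow> 'm::real_vector" where
  "middle_assoc l r q m p = r (l q m) p - l q (r m p)"

locale left_octonion_module =
  fixes l :: "octonion \<Rightarrow> 'm \<Rightarrow> 'm::real_vector"
  assumes l_bilinear: "bilinear l"
    and l_one: "l 1 m = m"
    and left_assoc_skew: "left_assoc l p q m = - left_assoc l q p m"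

locale octonion_bimodule = left_octonion_module l
  for l :: "octonion \<Rightarrow> 'm \<Rightarrow> 'm::real_vector" +
  fixes r :: "'m \<Rightarrow> octonion \<Rightarrow> 'm"
  assumes r_bilinear: "bilinear r"
    and r_one: "r m 1 = m"
    and left_right_assoc: "left_assoc l p q m = right_assoc r m p q"
    and right_middle_assoc: "right_assoc r m p q = middle_assoc l r q m p"

lemma bilinear_octonion_times: "bilinear ((*) :: octonion \<Rightarrow> octonion \<Rightarrow> octonion)"
  unfolding bilinear_def linear_iff octonion_eq_iff ball_atMost_7
  by (simp add: coord_times_explicit coord_simps algebra_simps del: One_nat_def)

lemma octonion_regular_bimodule:
  "octonion_bimodule ((*) :: octonion \<Rightarrow> octonion \<Rightarrow> octonion) (*)"
proof -
  define A where "A p q m = (p * q) * m - p * (q * m)" for p q m :: octonion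
  note distrib = bilinear_ladd[OF bilinear_octonion_times] bilinear_radd[OF bilinear_octonion_times]
  have l0: "A x x y = 0" and r0: "A y x x = 0" for x y
    by (simp_all add: A_def octonion_left_alternative octonion_right_alternative)
  have "A (p + q) (p + q) m = A p p m + A p q m + A q p m + A q q m" for p q m
    by (simp add: A_def distrib)
  then have l: "A p q m = - A q p m" for p q m
    by (simp add: l0 eq_neg_iff_add_eq_0)
  have "A m (p + q) (p + q) = A m p p + A m p q + A m q p + A m q q" for p q m
    by (simp add: A_def distrib)
  then have r: "A m p q = - A m q p" for p q m
    by (simp add: r0 eq_neg_iff_add_eq_0)
  have one: "1 * m = m" "m * 1 = m" for m :: octonion
    unfolding octonion_eq_iff ball_atMost_7
    by (simp_all add: coord_times_explicit coord_simps del: One_nat_def)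
  have "A p q m = A m p q" "A m p q = A q m p" for p q m
    using l r by (metis minus_minus)+
  then show ?thesis
    using l by unfold_locales
      (simp_all add: left_assoc_def right_assoc_def middle_assoc_def bilinear_octonion_times one A_def)
qed

definition assoc_part :: "(octonion \<Rightarrow> 'm \<Rightarrow> 'm) \<Rightarrow> 'm::real_vector set" where
  "assoc_part l = {m. \<forall>p q. left_assoc l p q m = 0}"

end

theory Submission
  imports Defs
begin

text \<open>Left multiplications \<open>L\<^sub>i\<close> by the units anticommute and square to \<open>-1\<close>. For each of the seven
  oriented lines put \<open>g = - L\<^sub>i L\<^sub>j L\<^sub>k\<close>; these are commuting involutions, an element is associative iff
  every \<open>g\<close> fixes it, and the map in the theorem is \<open>(1 + \<Sum> g) / 8\<close>. It is therefore the projection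
  onto the associative part as soon as the seven \<open>g\<close> together with \<open>1\<close> form a group, i.e. as soon as
  the product of the three \<open>g\<close> through a point is \<open>1\<close>, equivalently \<open>L\<^sub>1 L\<^sub>2 L\<^sub>3 L\<^sub>4 L\<^sub>5 L\<^sub>6 = L\<^sub>7\<close>. This fails
  for left modules such as the conjugate regular one, and it is where the right action enters:
  \<open>R\<^sub>i = - L\<^sub>i\<close> on the \<open>-1\<close> eigenspace of a \<open>g\<close> through \<open>i\<close>, while \<open>R\<^sub>i\<close> commutes with \<open>L\<^sub>p\<close> on the \<open>+1\<close>
  eigenspace of the \<open>g\<close> of a line \<open>(i, p, q)\<close>; this excludes the eigenvalue patterns of product \<open>-1\<close>.\<close>

section \<open>Products of units along the Fano lines\<close>

lemma eps_eq_1_cases: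
  assumes "eps i j k = 1"
  shows "(i, j, k) \<in> {(1,2,3), (2,3,1), (3,1,2), (1,4,5), (4,5,1), (5,1,4), (1,7,6), (7,6,1), (6,1,7),
    (2,4,6), (4,6,2), (6,2,4), (2,5,7), (5,7,2), (7,2,5), (3,4,7), (4,7,3), (7,3,4), (3,6,5), (6,5,3), (5,3,6)}"
proof -
  have "(i,j,k) \<in> fano_lines \<or> (j,k,i) \<in> fano_lines \<or> (k,i,j) \<in> fano_lines"
    using assms by (simp add: eps_def split: if_splits)
  then show ?thesis
    unfolding fano_lines_def insert_iff empty_iff prod.inject by (elim disjE conjE FalseE) simp_all
qed

lemma eps_rotate: "eps j k i = eps i j k"
  unfolding eps_def by (simp add: disj_ac)

lemma unit_oct_anticommute:
  assumes "i \<in> {1..7}" "j \<in> {1..7}"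
  shows "unit_oct i * unit_oct j + unit_oct j * unit_oct i = (if i = j then - 2 else 0) *\<^sub>R 1"
proof -
  \<comment> \<open>For imaginary octonions the cross product terms cancel and only the inner
    product survives.\<close>
  have imaginary: "x * y + y * x = (- 2 * (\<Sum>n=1..7. coord x n * coord y n)) *\<^sub>R 1"
    if "coord x 0 = 0" "coord y 0 = 0" for x y
    using that unfolding octonion_eq_iff ball_atMost_7 sum_1_7
    by (simp add: coord_times_explicit coord_simps algebra_simps del: One_nat_def)
  have "(\<Sum>n=1..7. coord (unit_oct i) n * coord (unit_oct j) n) = (\<Sum>n=1..7. if n = i then (if i = j then 1 else 0) else 0)"
    by (rule sum.cong) (use assms in \<open>auto simp: coord_simps\<close>)
  with assms show ?thesis
    by (subst imaginary) (simp_all add: coord_simps)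
qed

lemma octonion_expand: "p = coord p 0 *\<^sub>R 1 + (\<Sum>i=1..7. coord p i *\<^sub>R unit_oct i)"
  unfolding octonion_eq_iff ball_atMost_7 sum_1_7
  by (simp add: coord_simps del: One_nat_def)

lemma fano_range:
  assumes "eps i j k = 1"
  shows "i \<in> {1..7}" "j \<in> {1..7}" "k \<in> {1..7}" "i \<noteq> j" "j \<noteq> k" "k \<noteq> i"
  using eps_eq_1_cases[OF assms] by auto

lemma fano_product:
  assumes "eps i j k = 1"
  shows "unit_oct i * unit_oct j = unit_oct k"
  using eps_eq_1_cases[OF assms] unfolding insert_iff empty_iff prod.inject
  by (elim disjE conjE FalseE; hypsubst)
    (simp_all add: octonion_eq_iff ball_atMost_7 coord_times_explicit coord_simps del: One_nat_def)


lemma fano_line_through: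
  assumes "i \<in> {1..7}" "j \<in> {1..7}" "i \<noteq> j"
  obtains k where "eps i j k = 1 \<or> eps j i k = 1"
proof -
  have "{1..7} = {1,2,3,4,5,6,7::nat}" by auto
  then have "\<exists>k\<in>{1,2,3,4,5,6,7}. eps i j k = 1 \<or> eps j i k = 1"
    using assms unfolding \<open>{1..7} = _\<close> insert_iff empty_iff
    by (elim disjE FalseE; hypsubst) (simp_all add: eps_def fano_lines_def del: One_nat_def)
  with that show thesis by blast
qed

lemma eq_uminus_imp_zero: "x = - x \<Longrightarrow> x = 0" for x :: "'a::real_vector"
  by (simp add: eq_neg_iff_add_eq_0 scaleR_2[symmetric])

lemma octonion_one: "1 * x = x" "x * 1 = x" for x :: octonion
  using octonion_bimodule.axioms(1)[OF octonion_regular_bimodule] octonion_bimodule.r_one[OF octonion_regular_bimodule]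
  by (auto dest: left_octonion_module.l_one)

section \<open>Left multiplications and the Clifford relations\<close>

context left_octonion_module
begin

abbreviation L :: "nat \<Rightarrow> 'm \<Rightarrow> 'm" where
  "L i \<equiv> l (unit_oct i)"

lemmas l_linear_simps = bilinear_ladd[OF l_bilinear] bilinear_radd[OF l_bilinear]
  bilinear_lsub[OF l_bilinear] bilinear_rsub[OF l_bilinear]
  bilinear_lneg[OF l_bilinear] bilinear_rneg[OF l_bilinear]
  bilinear_lmul[OF l_bilinear] bilinear_rmul[OF l_bilinear]
  bilinear_lzero[OF l_bilinear] bilinear_rzero[OF l_bilinear]

lemma bilinear_left_assoc: "bilinear (\<lambda>p q. left_assoc l p q m)"
  unfolding bilinear_def linear_iff left_assoc_def
  by (simp add: l_linear_simps bilinear_ladd[OF bilinear_octonion_times] bilinear_radd[OF bilinear_octonion_times]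
      bilinear_lmul[OF bilinear_octonion_times] bilinear_rmul[OF bilinear_octonion_times] scaleR_diff_right)

lemma L_anticommute:
  assumes "i \<in> {1..7}" "j \<in> {1..7}"
  shows "L i (L j m) + L j (L i m) = (if i = j then - 2 else 0) *\<^sub>R m"
proof -
  have "L i (L j m) + L j (L i m) = l (unit_oct i * unit_oct j + unit_oct j * unit_oct i) m"
    using left_assoc_skew[of "unit_oct i" "unit_oct j" m]
    by (simp add: left_assoc_def l_linear_simps algebra_simps)
  then show ?thesis
    by (simp add: unit_oct_anticommute[OF assms] l_linear_simps l_one)
qed

lemma L_square: "i \<in> {1..7} \<Longrightarrow> L i (L i m) = - m"
  using L_anticommute[of i i m] scaleR_cancel_left[of 2 "L i (L i m)" "- m"] by (simp add: scaleR_2)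

lemma L_swap: "i \<in> {1..7} \<Longrightarrow> j \<in> {1..7} \<Longrightarrow> i \<noteq> j \<Longrightarrow> L i (L j m) = - L j (L i m)"
  using L_anticommute[of i j m] by (simp add: eq_neg_iff_add_eq_0)

lemma left_assoc_line: "eps i j k = 1 \<Longrightarrow> left_assoc l (unit_oct i) (unit_oct j) m = L k m - L i (L j m)"
  by (simp add: left_assoc_def fano_product)

text \<open>The associator is bilinear and skew in its two octonions and vanishes when one of them
  is \<open>1\<close>. Two distinct units lie on a common line, so testing oriented lines is
  enough.\<close>

lemma assoc_partI:
  assumes "\<And>i j k. eps i j k = 1 \<Longrightarrow> L i (L j m) = L k m"
  shows "m \<in> assoc_part l"
proof -
  let ?A = "\<lambda>p q. left_assoc l p q m"
  note bil = bilinear_left_assoc[of m]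
  have A1: "?A 1 q = 0" for q
    by (simp add: left_assoc_def l_one octonion_one)
  have A2: "?A p 1 = 0" for p
    by (simp add: left_assoc_def l_one octonion_one)
  have units: "?A (unit_oct i) (unit_oct j) = 0" if ij: "i \<in> {1..7}" "j \<in> {1..7}" for i j
  proof (cases "i = j")
    case True
    then show ?thesis
      using left_assoc_skew eq_uminus_imp_zero by blast
  next
    case False
    then obtain k where "eps i j k = 1 \<or> eps j i k = 1"
      using fano_line_through[OF ij] by blast
    then have "?A (unit_oct i) (unit_oct j) = 0 \<or> ?A (unit_oct j) (unit_oct i) = 0"
      using assms by (auto simp: left_assoc_line)
    then show ?thesis
      using left_assoc_skew[of "unit_oct i" "unit_oct j" m] by auto
  qed
  have "?A p q = 0" for p q
    by (subst octonion_expand[of p], subst octonion_expand[of q])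
      (auto simp: bilinear_ladd[OF bil] bilinear_radd[OF bil] bilinear_lmul[OF bil] bilinear_rmul[OF bil]
        bilinear_sum[OF bil] A1 A2 units simp del: One_nat_def intro!: sum.neutral)
  then show ?thesis
    by (simp add: assoc_part_def)
qed

text \<open>The condition \<open>j < i\<close> turns the swap into a terminating rewrite rule that
  sorts words.\<close>

lemma L_swap_ordered: "i \<in> {1..7} \<Longrightarrow> j \<in> {1..7} \<Longrightarrow> j < i \<Longrightarrow> L i (L j m) = - L j (L i m)"
  by (rule L_swap) auto

lemmas clifford_simps = l_linear_simps L_square L_swap_ordered

lemma L_cancel: "i \<in> {1..7} \<Longrightarrow> L i m = 0 \<Longrightarrow> m = 0"
  using L_square[of i m] by (simp add: l_linear_simps)

end

section \<open>Right multiplications and the volume element\<close>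

context octonion_bimodule
begin

abbreviation R :: "nat \<Rightarrow> 'm \<Rightarrow> 'm" where
  "R i m \<equiv> r m (unit_oct i)"

lemmas r_linear_simps = bilinear_ladd[OF r_bilinear] bilinear_radd[OF r_bilinear]
  bilinear_lsub[OF r_bilinear] bilinear_rsub[OF r_bilinear]
  bilinear_lneg[OF r_bilinear] bilinear_rneg[OF r_bilinear]
  bilinear_lmul[OF r_bilinear] bilinear_rmul[OF r_bilinear]
  bilinear_lzero[OF r_bilinear] bilinear_rzero[OF r_bilinear]

lemma R_anticommute:
  assumes "i \<in> {1..7}" "j \<in> {1..7}"
  shows "R i (R j m) + R j (R i m) = (if i = j then - 2 else 0) *\<^sub>R m"
proof -
  have "R i (R j m) + R j (R i m) = r m (unit_oct i * unit_oct j + unit_oct j * unit_oct i)"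
    using left_assoc_skew[of "unit_oct i" "unit_oct j" m]
    by (simp add: left_right_assoc right_assoc_def r_linear_simps algebra_simps)
  then show ?thesis
    by (simp add: unit_oct_anticommute[OF assms] r_linear_simps r_one)
qed

lemma R_square: "i \<in> {1..7} \<Longrightarrow> R i (R i m) = - m"
  using R_anticommute[of i i m] scaleR_cancel_left[of 2 "R i (R i m)" "- m"] by (simp add: scaleR_2)

lemma R_swap: "i \<in> {1..7} \<Longrightarrow> j \<in> {1..7} \<Longrightarrow> i \<noteq> j \<Longrightarrow> R i (R j m) = - R j (R i m)"
  using R_anticommute[of i j m] by (simp add: eq_neg_iff_add_eq_0)

lemma right_assoc_line: "eps i j k = 1 \<Longrightarrow> left_assoc l (unit_oct i) (unit_oct j) m = R j (R i m) - R k m"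
  by (simp add: left_right_assoc right_assoc_def fano_product)

lemma R_L_commutator: "R i (L j m) = L j (R i m) + left_assoc l (unit_oct i) (unit_oct j) m"
  by (simp add: left_right_assoc right_middle_assoc middle_assoc_def)

text \<open>Up to sign both sides equal the associator of \<open>e_k\<close> and \<open>e_i\<close>,
  expanded once by right and once by left multiplications.\<close>

lemma R_left_assoc:
  assumes "eps i j k = 1"
  shows "R i (left_assoc l (unit_oct i) (unit_oct j) m) = - L i (left_assoc l (unit_oct i) (unit_oct j) m)"
proof -
  note range = fano_range[OF assms]
  have kij: "eps k i j = 1"
    using assms eps_rotate by metis
  have "R i (left_assoc l (unit_oct i) (unit_oct j) m) = - left_assoc l (unit_oct k) (unit_oct i) m"
    using range R_swap[of i j "R i m"]
    by (simp add: right_assoc_line[OF assms] right_assoc_line[OF kij] r_linear_simps R_square)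
  moreover have "L i (left_assoc l (unit_oct i) (unit_oct j) m) = left_assoc l (unit_oct k) (unit_oct i) m"
    using range L_swap[of i k m]
    by (simp add: left_assoc_line[OF assms] left_assoc_line[OF kij] l_linear_simps L_square)
  ultimately show ?thesis by simp
qed

lemma R_eq_minus_L:
  assumes "eps i j k = 1" and v: "L i (L j (L k v)) = v"
  shows "R i v = - L i v"
proof -
  \<comment> \<open>This exhibits \<open>v\<close> as a multiple of an associator, so
    \<open>R_left_assoc\<close> applies to it.\<close>
  have "left_assoc l (unit_oct i) (unit_oct j) (L k v) = - 2 *\<^sub>R v"
    using v fano_range[OF assms(1)] by (simp add: left_assoc_line[OF assms(1)] L_square scaleR_2)
  then have "2 *\<^sub>R R i v = 2 *\<^sub>R (- L i v)"
    using R_left_assoc[OF assms(1), of "L k v"]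
    by (simp add: l_linear_simps r_linear_simps minus_equation_iff[of "2 *\<^sub>R R i v"])
  then show ?thesis
    by (simp only: scaleR_cancel_left) simp
qed

lemma R_L_commute:
  assumes "eps i j k = 1" and v: "L i (L j (L k v)) = - v"
  shows "R i (L j v) = L j (R i v)"
proof -
  note range = fano_range[OF assms(1)]
  have "L k (L i (L j (L k v))) = L i (L j (L k (L k v)))"
    using range L_swap[of k i "L j (L k v)"] L_swap[of k j "L k v"] by (simp add: l_linear_simps)
  then have "L i (L j v) = L k v"
    using range v by (simp add: L_square l_linear_simps)
  then show ?thesis
    by (simp add: R_L_commutator left_assoc_line[OF assms(1)])
qed

text \<open>\<open>R i (L p v)\<close> is computed twice: moving \<open>R i\<close> past
  \<open>L p\<close> gives \<open>L i (L p v)\<close>. As \<open>p\<close> lies off the line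
  \<open>(i, s, t)\<close>, \<open>L p\<close> swaps the two eigenspaces of that line, which gives
  \<open>- L i (L p v)\<close>.\<close>

lemma fano_signs_impossible:
  assumes "eps i j k = 1" "eps i p q = 1" "eps i s t = 1" "p \<noteq> s" "p \<noteq> t"
    and "L i (L j (L k v)) = v" "L i (L p (L q v)) = - v" "L i (L s (L t v)) = - v"
  shows "v = 0"
proof -
  note range = fano_range[OF assms(1)] fano_range[OF assms(2)] fano_range[OF assms(3)]
  have "R i (L p v) = L i (L p v)"
    using R_L_commute[OF assms(2,7)] R_eq_minus_L[OF assms(1,6)] range L_swap[of i p v]
    by (simp add: l_linear_simps)
  moreover have "L i (L s (L t (L p v))) = - L p (L i (L s (L t v)))"
    using range assms(4,5) L_swap[of p i "L s (L t v)"] L_swap[of p s "L t v"] L_swap[of p t v]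
    by (simp add: l_linear_simps)
  then have "R i (L p v) = - L i (L p v)"
    using assms(8) by (intro R_eq_minus_L[OF assms(3)]) (simp add: l_linear_simps)
  ultimately have "L i (L p v) = 0"
    using eq_uminus_imp_zero[of "L i (L p v)"] by simp
  then show ?thesis
    using range L_cancel by blast
qed

lemma volume_element: "L 1 (L 2 (L 3 (L 4 (L 5 (L 6 m))))) = L 7 m"
proof -
  define a b c where "a x = - L 1 (L 2 (L 3 x))" "b x = - L 1 (L 4 (L 5 x))" "c x = - L 1 (L 7 (L 6 x))" for x
  note defs = a_b_c_def
  have lines: "eps 1 2 3 = 1" "eps 1 4 5 = 1" "eps 1 7 6 = 1"
    by (simp_all add: eps_def fano_lines_def del: One_nat_def)
  have abc: "a (a x) = x" "b (b x) = x" "c (c x) = x" "b (a x) = a (b x)" "c (a x) = a (c x)" "c (b x) = b (c x)"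
    "a (L 4 x) = - L 4 (a x)" "c (L 4 x) = - L 4 (c x)" "b (L 4 x) = L 4 (b x)" for x
    by (simp_all add: defs clifford_simps del: One_nat_def)
  have lin: "a (x + y) = a x + a y" "a (x - y) = a x - a y" "b (x + y) = b x + b y" "b (x - y) = b x - b y"
    "c (x + y) = c x + c y" "c (x - y) = c x - c y" "a (- x) = - a x" "b (- x) = - b x" "c (- x) = - c x" for x y
    by (simp_all add: defs l_linear_simps del: One_nat_def)
  have words: "L 1 (L 2 (L 3 x)) = - a x" "L 1 (L 4 (L 5 x)) = - b x" "L 1 (L 7 (L 6 x)) = - c x" for x
    by (simp_all add: defs)
  have a_odd: "x = 0" if "a x = - x" "b x = x" "c x = x" for x
    by (rule fano_signs_impossible[OF lines])
      (simp_all add: words that del: One_nat_def)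
  have b_odd: "x = 0" if "a x = x" "b x = - x" "c x = x" for x
    by (rule fano_signs_impossible[OF lines(2,1,3)])
      (simp_all add: words that del: One_nat_def)
  have c_odd: "x = 0" if "a x = x" "b x = x" "c x = - x" for x
    by (rule fano_signs_impossible[OF lines(3,1,2)])
      (simp_all add: words that del: One_nat_def)
  \<comment> \<open>\<open>L\<^sub>4\<close> anticommutes with \<open>a\<close> and \<open>c\<close> and commutes with \<open>b\<close>, so it turns the signs
    \<open>(-,-,-)\<close> into \<open>(+,-,+)\<close>.\<close>
  have all_odd: "x = 0" if "a x = - x" "b x = - x" "c x = - x" for x
    by (rule L_cancel[of 4], simp, rule b_odd) (use that in \<open>simp_all add: abc l_linear_simps\<close>)
  \<comment> \<open>\<open>w s t u = (1 + s a) (1 + t b) (1 + u c) x\<close> is a multiple of the projection of \<open>x\<close> to the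
    eigenspace with signs \<open>(s, t, u)\<close>.\<close>
  have word: "a (b (c x)) = x" for x
  proof -
    define w where "w s t u =
      x + s *\<^sub>R a x + t *\<^sub>R b x + u *\<^sub>R c x + (s * t) *\<^sub>R a (b x) + (s * u) *\<^sub>R a (c x)
        + (t * u) *\<^sub>R b (c x) + (s * t * u) *\<^sub>R a (b (c x))" for s t u :: real
    have "w (-1) 1 1 = 0" "w 1 (-1) 1 = 0" "w 1 1 (-1) = 0" "w (-1) (-1) (-1) = 0"
      by (rule a_odd b_odd c_odd all_odd; simp add: w_def abc lin)+
    then have "w (-1) 1 1 + w 1 (-1) 1 + w 1 1 (-1) + w (-1) (-1) (-1) = 0"
      by simp
    \<comment> \<open>Over the four sign patterns of product -1 all terms but the first and the last
      cancel.\<close>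
    moreover have "w (-1) 1 1 + w 1 (-1) 1 + w 1 1 (-1) + w (-1) (-1) (-1) = 4 *\<^sub>R (x - a (b (c x)))"
    proof -
      have "4 *\<^sub>R y = y + y + y + y" for y :: 'm
        using scaleR_add_left[of 2 2 y] by (simp add: scaleR_2)
      then show ?thesis by (simp add: w_def)
    qed
    ultimately show ?thesis by simp
  qed
  show ?thesis
    \<comment> \<open>At \<open>L 7 m\<close> both factors \<open>L 7\<close> and two of the three
      \<open>L 1\<close> cancel.\<close>
    using word[of "L 7 m"] by (simp add: defs clifford_simps del: One_nat_def)
qed

text \<open>Each of the seven lines occurs in six orders, each contributing
  \<open>- x - L i (L j (L k x))\<close>; hence 48 = 6 * 8.\<close>

lemma fano_averaging:
  "x + (1/48) *\<^sub>R (\<Sum>i=1..7. \<Sum>j=1..7. \<Sum>k=1..7.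
      eps i j k *\<^sub>R L i (left_assoc l (unit_oct j) (unit_oct k) x)) =
   (1/8) *\<^sub>R (x - L 1 (L 2 (L 3 x)) - L 1 (L 4 (L 5 x)) - L 1 (L 7 (L 6 x)) - L 2 (L 4 (L 6 x))
     - L 2 (L 5 (L 7 x)) - L 3 (L 4 (L 7 x)) - L 3 (L 6 (L 5 x)))" (is "x + _ *\<^sub>R ?S = _ *\<^sub>R ?P")
proof -
  have assoc: "left_assoc l (unit_oct i) (unit_oct j) x = L k x - L i (L j x)"
    "left_assoc l (unit_oct j) (unit_oct i) x = L i (L j x) - L k x" if "eps i j k = 1" for i j k
    using that left_assoc_skew[of "unit_oct j" "unit_oct i" x] by (simp_all add: left_assoc_line)
  have eps1: "eps 1 2 3 = 1" "eps 2 3 1 = 1" "eps 3 1 2 = 1"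
    "eps 1 4 5 = 1" "eps 4 5 1 = 1" "eps 5 1 4 = 1"
    "eps 1 7 6 = 1" "eps 7 6 1 = 1" "eps 6 1 7 = 1"
    "eps 2 4 6 = 1" "eps 4 6 2 = 1" "eps 6 2 4 = 1"
    "eps 2 5 7 = 1" "eps 5 7 2 = 1" "eps 7 2 5 = 1"
    "eps 3 4 7 = 1" "eps 4 7 3 = 1" "eps 7 3 4 = 1"
    "eps 3 6 5 = 1" "eps 6 5 3 = 1" "eps 5 3 6 = 1"
    by (simp_all add: eps_def fano_lines_def del: One_nat_def)
  \<comment> \<open>Multiples become repeated sums, so that both sides normalise as sums of
    words.\<close>
  have six: "6 *\<^sub>R y = y + y + y + y + y + y"
    and eight: "8 *\<^sub>R y = y + y + y + y + y + y + y + y" for y :: 'm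
    by (simp_all flip: scaleR_2 scaleR_left_distrib add: scaleR_left_distrib[of _ 1, simplified, symmetric])
  have "?S = - (6 *\<^sub>R (8 *\<^sub>R x - ?P))"
    unfolding sum_1_7 six eight
    by (simp add: eps_def fano_lines_def eps1[THEN assoc(1)] eps1[THEN assoc(2)]
        clifford_simps algebra_simps del: One_nat_def)
  then show ?thesis
    by (simp add: scaleR_right_diff_distrib)
qed

text \<open>Rewriting \<open>L\<^sub>7\<close> by the volume element makes the sorted words in \<open>L\<^sub>1, \<dots>, L\<^sub>6\<close> a normal form.\<close>
lemma fano_average_assoc:
  "x - L 1 (L 2 (L 3 x)) - L 1 (L 4 (L 5 x)) - L 1 (L 7 (L 6 x)) - L 2 (L 4 (L 6 x))
     - L 2 (L 5 (L 7 x)) - L 3 (L 4 (L 7 x)) - L 3 (L 6 (L 5 x)) \<in> assoc_part l" (is "?P \<in> _")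
proof (rule assoc_partI)
  fix i j k assume "eps i j k = 1"
  then show "L i (L j ?P) = L k ?P"
        using eps_eq_1_cases[OF \<open>eps i j k = 1\<close>] unfolding insert_iff empty_iff prod.inject
    by (elim disjE conjE FalseE; hypsubst) (simp_all add: volume_element[symmetric] clifford_simps algebra_simps del: One_nat_def)
qed

end

theorem corollary4p5:
  fixes l :: "octonion \<Rightarrow> 'm \<Rightarrow> 'm::real_vector"
    and r :: "'m \<Rightarrow> octonion \<Rightarrow> 'm"
  assumes "octonion_bimodule l r"
  shows "assoc_part l =
    {x + (1/48) *\<^sub>R (\<Sum>i=1..7. \<Sum>j=1..7. \<Sum>k=1..7.
        eps i j k *\<^sub>R l (unit_oct i) (left_assoc l (unit_oct j) (unit_oct k) x)) | x. True}"
    (is "_ = {?P x | x. True}")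
proof -
  interpret octonion_bimodule l r by fact
  have "?P x \<in> assoc_part l" for x
    unfolding fano_averaging using fano_average_assoc[of x]
    by (simp add: assoc_part_def left_assoc_def l_linear_simps flip: scaleR_diff_right)
  \<comment> \<open>All associators of \<open>x\<close> vanish, so the map fixes
    \<open>x\<close>.\<close>
  moreover have "x = ?P x" if "x \<in> assoc_part l" for x
    using that by (simp add: assoc_part_def l_linear_simps)
  ultimately show ?thesis
    by blast
qed

end
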